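(* Let $(e_i)_{i\in\mathbb{N}}$ be the unit vector basis of $c_0$ and let $(e_i')_{i\in\mathbb{N}}$ be its sequence of biorthogonal functionals. For all $i\ge 2$ set $$x_i:=e_i+(-1)^{i}e_1,\qquad x_i':=e_i'.$$ The following statements hold: (a) $(x_i)_{i\ge 2}$ is a fundamental minimal system for $c_0$ (with biorthogonal functionals $(x_i')_{i\ge 2}$), but not a Markushevich basis. Thus, it is not quasi-greedy. (b) $(x_i)_{i\ge 2}$ is not democratic. (c) $(x_i)_{i\ge 2}$ is a semi-greedy system for $c_0$ with semi-greedy constant no greater than $3$. Moreover, for any $0<\tau\le 1$, any $x\in c_0$, any $m\in\mathbb{N}$ and every $m$-weak thresholding set $\mathcal{W}^{\tau}(x,m)$ for $x$ with weakness parameter $\tau$, there are scalars $(b_i)_{i\in \mathcal{W}^{\tau}(x,m)}$ such that $$\Big\|x-\sum_{i\in \mathcal{W}^{\tau}(x,m)}b_ix_i\Big\|\le 3\tau^{-1}\sigma_{m}(x).$$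
   Context: The scalar field is $\mathbb{R}$ or $\mathbb{C}$; all index sets below are $\{i\in\mathbb{N}: i\ge2\}$ and $[\,\cdot\,]$ denotes linear span. A system $(x_i)_i$ in a Banach space $X$ is fundamental if $X=\overline{[x_i]}$, minimal if there are $x_i'\in X'$ with $x_i'(x_j)=\delta_{ij}$. A fundamental minimal system is a Markushevich basis if $(x_i')_i$ is total: $x_i'(x)=0$ for all $i$ implies $x=0$. $\mathrm{supp}(x)=\{i:x_i'(x)\ne0\}$; for finite $A$, $P_A(x)=\sum_{i\in A}x_i'(x)x_i$; $\sigma_m(x)=\inf\{\|x-y\|: |\mathrm{supp}(y)|\le m,\ y=P_{\mathrm{supp}(y)}(y)\}$. The greedy ordering $\rho(x,\cdot)$ is the injective map from $\mathbb{N}$ to the index set whose range contains $\mathrm{supp}(x)$, with $|x'_{\rho(x,i)}(x)|\ge|x'_{\rho(x,j)}(x)|$ for $i\le j$, ties broken so that $i<j$ and $|x'_{\rho(x,i)}(x)|=|x'_{\rho(x,j)}(x)|$ imply $\rho(x,i)<\rho(x,j)$. $\mathcal{GS}_m(x)=\{\rho(x,i):1\le i\le m\}$, $\mathcal{G}_m(x)=P_{\mathcal{GS}_m(x)}(x)$. Quasi-greedy: $(x_i')_i$ bounded and there is $M>0$ with $\|\mathcal{G}_m(x)\|\le M\|x\|$ for all $x$ and $m$. Democratic: there is $K>0$ with $\|\sum_{i\in A}x_i\|\le K\|\sum_{j\in B}x_j\|$ for all finite $A,B$ with $|A|\le|B|$. Semi-greedy: $(x_i')_i$ bounded and there is $M>0$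 such that for every $x$ and $m\in\mathbb{N}$ there is $z\in[x_i:i\in\mathcal{GS}_m(x)]$ with $\|x-z\|\le M\sigma_m(x)$; the minimum $M$ is the semi-greedy constant. For $0<\tau\le1$, an $m$-weak thresholding set $\mathcal{W}^\tau(x,m)$ for $x$ with weakness parameter $\tau$ is a set of $m$ indices with $|x_i'(x)|\ge\tau|x_j'(x)|$ for all $i\in\mathcal{W}^\tau(x,m)$ and all indices $j\notin\mathcal{W}^\tau(x,m)$. *)

theory Defs
  imports "HOL-Analysis.Analysis"
begin

section \<open>Systems in Banach spaces over the real or complex field\<close>

text \<open>
  The scalar field is a type of class \<open>{real_normed_field, heine_borel}\<close>. Both
  \<^typ>\<open>real\<close> and \<^typ>\<open>complex\<close> are instances, and by the Gelfand-Mazur theorem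
  they are, up to isometric isomorphism, the only ones. The type class \<^class>\<open>banach\<close> only knows
  multiplication by real scalars, so the scalar multiplication is a locale parameter.
  All systems are indexed by \<open>{2..}\<close>; values of a family at 0 and 1 are ignored.
\<close>

locale banach_space_over = vector_space scale
  for scale :: "'k::{real_normed_field, heine_borel} \<Rightarrow> 'v::banach \<Rightarrow> 'v" (infixr \<open>\<odot>\<close> 75) +
  assumes norm_scale: "norm (c \<odot> v) = norm c * norm v"
    and scale_of_real: "of_real r \<odot> v = r *\<^sub>R v"
begin

text \<open>The topological dual.\<close>

definition dual :: "('v \<Rightarrow> 'k) set" where
  "dual = {f. Vector_Spaces.linear scale (*) f \<and> continuous_on UNIV f}"

definition fundamental :: "(nat \<Rightarrow> 'v) \<Rightarrow> bool" where
  "fundamental x \<longleftrightarrow> closure (span (x ` {2..})) = UNIV"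

definition biorthogonal :: "(nat \<Rightarrow> 'v) \<Rightarrow> (nat \<Rightarrow> 'v \<Rightarrow> 'k) \<Rightarrow> bool" where
  "biorthogonal x x' \<longleftrightarrow> (\<forall>i\<ge>2. x' i \<in> dual) \<and>
     (\<forall>i\<ge>2. \<forall>j\<ge>2. x' i (x j) = (if i = j then 1 else 0))"

definition minimal :: "(nat \<Rightarrow> 'v) \<Rightarrow> bool" where
  "minimal x \<longleftrightarrow> (\<exists>x'. biorthogonal x x')"

definition total :: "(nat \<Rightarrow> 'v \<Rightarrow> 'k) \<Rightarrow> bool" where
  "total x' \<longleftrightarrow> (\<forall>v. (\<forall>i\<ge>2. x' i v = 0) \<longrightarrow> v = 0)"

text \<open>For a fundamental system the biorthogonal functionals are unique on \<open>{2..}\<close>.\<close>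

definition markushevich_basis :: "(nat \<Rightarrow> 'v) \<Rightarrow> bool" where
  "markushevich_basis x \<longleftrightarrow> fundamental x \<and> (\<exists>x'. biorthogonal x x' \<and> total x')"

definition bounded_functionals :: "(nat \<Rightarrow> 'v \<Rightarrow> 'k) \<Rightarrow> bool" where
  "bounded_functionals x' \<longleftrightarrow> bdd_above ((\<lambda>i. onorm (x' i)) ` {2..})"

definition supp :: "(nat \<Rightarrow> 'v \<Rightarrow> 'k) \<Rightarrow> 'v \<Rightarrow> nat set" where
  "supp x' v = {i. 2 \<le> i \<and> x' i v \<noteq> 0}"

definition proj :: "(nat \<Rightarrow> 'v) \<Rightarrow> (nat \<Rightarrow> 'v \<Rightarrow> 'k) \<Rightarrow> nat set \<Rightarrow> 'v \<Rightarrow> 'v" where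
  "proj x x' A v = (\<Sum>i\<in>A. x' i v \<odot> x i)"

definition sigma :: "(nat \<Rightarrow> 'v) \<Rightarrow> (nat \<Rightarrow> 'v \<Rightarrow> 'k) \<Rightarrow> nat \<Rightarrow> 'v \<Rightarrow> real" where
  "sigma x x' m v = Inf {norm (v - y) |y.
     finite (supp x' y) \<and> card (supp x' y) \<le> m \<and> y = proj x x' (supp x' y) y}"

text \<open>
  The greedy ordering is a map on the positive integers. The conditions determine it on the initial
  segment that enumerates the support of \<open>v\<close>. If the support is finite, they do not determine which
  further indices follow (e.g. when \<open>v\<close> is annihilated by all functionals, any strictly increasing
  map is admissible). Hence the ordering is a predicate, and the definitions below
  quantify universally over all admissible orderings; that there always is one is shown in
  \<open>greedy_ordering_exists\<close>.
\<close>

definition greedy_ordering :: "(nat \<Rightarrow> 'v \<Rightarrow> 'k) \<Rightarrow> 'v \<Rightarrow> (nat \<Rightarrow> nat) \<Rightarrow> bool" where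
  "greedy_ordering x' v \<rho> \<longleftrightarrow>
     inj_on \<rho> {1..} \<and> \<rho> ` {1..} \<subseteq> {2..} \<and> supp x' v \<subseteq> \<rho> ` {1..} \<and>
     (\<forall>i j. 1 \<le> i \<and> i \<le> j \<longrightarrow> norm (x' (\<rho> i) v) \<ge> norm (x' (\<rho> j) v)) \<and>
     (\<forall>i j. 1 \<le> i \<and> i < j \<and> norm (x' (\<rho> i) v) = norm (x' (\<rho> j) v) \<longrightarrow> \<rho> i < \<rho> j)"

definition greedy_set :: "(nat \<Rightarrow> nat) \<Rightarrow> nat \<Rightarrow> nat set" where
  "greedy_set \<rho> m = \<rho> ` {1..m}"

definition greedy_sum ::
    "(nat \<Rightarrow> 'v) \<Rightarrow> (nat \<Rightarrow> 'v \<Rightarrow> 'k) \<Rightarrow> (nat \<Rightarrow> nat) \<Rightarrow> nat \<Rightarrow> 'v \<Rightarrow> 'v" where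
  "greedy_sum x x' \<rho> m v = proj x x' (greedy_set \<rho> m) v"

definition quasi_greedy :: "(nat \<Rightarrow> 'v) \<Rightarrow> (nat \<Rightarrow> 'v \<Rightarrow> 'k) \<Rightarrow> bool" where
  "quasi_greedy x x' \<longleftrightarrow> bounded_functionals x' \<and>
     (\<exists>M>0. \<forall>v m \<rho>. greedy_ordering x' v \<rho> \<longrightarrow> norm (greedy_sum x x' \<rho> m v) \<le> M * norm v)"

definition democratic :: "(nat \<Rightarrow> 'v) \<Rightarrow> bool" where
  "democratic x \<longleftrightarrow> (\<exists>K>0. \<forall>A B. A \<subseteq> {2..} \<and> B \<subseteq> {2..} \<and> finite A \<and> finite B \<and> card A \<le> card B \<longrightarrow>
     norm (\<Sum>i\<in>A. x i) \<le> K * norm (\<Sum>j\<in>B. x j))"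

definition semi_greedy_bound :: "(nat \<Rightarrow> 'v) \<Rightarrow> (nat \<Rightarrow> 'v \<Rightarrow> 'k) \<Rightarrow> real \<Rightarrow> bool" where
  "semi_greedy_bound x x' M \<longleftrightarrow> M > 0 \<and>
     (\<forall>v m \<rho>. greedy_ordering x' v \<rho> \<longrightarrow>
        (\<exists>z \<in> span (x ` greedy_set \<rho> m). norm (v - z) \<le> M * sigma x x' m v))"

definition semi_greedy :: "(nat \<Rightarrow> 'v) \<Rightarrow> (nat \<Rightarrow> 'v \<Rightarrow> 'k) \<Rightarrow> bool" where
  "semi_greedy x x' \<longleftrightarrow> bounded_functionals x' \<and> (\<exists>M. semi_greedy_bound x x' M)"

definition is_semi_greedy_constant :: "(nat \<Rightarrow> 'v) \<Rightarrow> (nat \<Rightarrow> 'v \<Rightarrow> 'k) \<Rightarrow> real \<Rightarrow> bool" where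
  "is_semi_greedy_constant x x' M \<longleftrightarrow>
     semi_greedy_bound x x' M \<and> (\<forall>M'. semi_greedy_bound x x' M' \<longrightarrow> M \<le> M')"

definition weak_thresholding_set ::
    "(nat \<Rightarrow> 'v \<Rightarrow> 'k) \<Rightarrow> real \<Rightarrow> 'v \<Rightarrow> nat \<Rightarrow> nat set \<Rightarrow> bool" where
  "weak_thresholding_set x' \<tau> v m W \<longleftrightarrow> W \<subseteq> {2..} \<and> finite W \<and> card W = m \<and>
     (\<forall>i\<in>W. \<forall>j\<in>{2..} - W. norm (x' i v) \<ge> \<tau> * norm (x' j v))"

lemma dual_bounded_linear:
  assumes "f \<in> dual"
  shows "bounded_linear f"
proof -
  interpret f: Vector_Spaces.linear scale "(*)" f
    using assms by (simp add: dual_def)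
  have lin: "linear f"
    by (rule linearI) (simp_all add: f.add scale_of_real[symmetric] f.scale scaleR_conv_of_real)
  have "isCont f 0"
    using assms by (simp add: dual_def continuous_on_eq_continuous_at)
  then obtain d where d: "d > 0" "\<And>v. dist v 0 < d \<Longrightarrow> dist (f v) (f 0) < 1"
    unfolding continuous_at_eps_delta by (metis zero_less_one)
  have "norm (f v) \<le> norm v * (2 / d)" for v
  proof (cases "v = 0")
    case False
    define r where "r = d / (2 * norm v)"
    have "norm (r *\<^sub>R v) < d" using False d(1) by (simp add: r_def)
    then have "norm (f (r *\<^sub>R v)) < 1" using d(2)[of "r *\<^sub>R v"] by simp
    then have "\<bar>r\<bar> * norm (f v) < 1" by (simp add: linear_cmul[OF lin])
    then show ?thesis using False d(1) by (simp add: r_def field_simps)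
  qed simp
  then show ?thesis
    by (intro bounded_linear_intro[of f "2 / d"]) (use lin linear_add linear_cmul in auto)
qed

lemma finite_large_coefficients:
  assumes "fundamental x" "biorthogonal x x'" "bounded_functionals x'" "e > 0"
  shows "finite {i. 2 \<le> i \<and> e \<le> norm (x' i v)}"
proof -
  obtain C0 where C0: "\<And>i. i \<ge> 2 \<Longrightarrow> onorm (x' i) \<le> C0"
    using assms(3) by (auto simp: bounded_functionals_def bdd_above_def)
  define C where "C = \<bar>C0\<bar> + 1"
  have "C > 0" by (simp add: C_def)
  have bl: "bounded_linear (x' i)" if "i \<ge> 2" for i
    using assms(2) that dual_bounded_linear by (simp add: biorthogonal_def)
  have C: "norm (x' i w) \<le> C * norm w" if "i \<ge> 2" for i w
  proof -
    have "norm (x' i w) \<le> onorm (x' i) * norm w" by (rule onorm[OF bl[OF that]])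
    also have "\<dots> \<le> C * norm w"
      using C0[OF that] by (intro mult_right_mono) (auto simp: C_def)
    finally show ?thesis .
  qed
  have "v \<in> closure (span (x ` {2..}))" using assms(1) by (simp add: fundamental_def)
  then obtain u where u: "u \<in> span (x ` {2..})" "dist u v < e / C"
    using \<open>C > 0\<close> assms(4) unfolding closure_approachable by (metis divide_pos_pos)
  obtain t r where t: "finite t" "t \<subseteq> x ` {2..}" "u = (\<Sum>a\<in>t. r a \<odot> a)"
    using u(1) unfolding span_explicit by blast
  obtain F where F: "F \<subseteq> {2..}" "finite F" "t = x ` F"
    using finite_subset_image[OF t(1,2)] by blast
  have "x' i u = 0" if i: "i \<ge> 2" "i \<notin> F" for i
  proof -
    interpret f: Vector_Spaces.linear scale "(*)" "x' i"
      using assms(2) i by (simp add: biorthogonal_def dual_def)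
    have "x' i a = 0" if "a \<in> t" for a
      using that F i assms(2) by (auto simp: biorthogonal_def)
    then show ?thesis by (simp add: t(3) f.sum f.scale)
  qed
  then have "norm (x' i v) < e" if i: "i \<ge> 2" "i \<notin> F" for i
  proof -
    have "x' i v = x' i (v - u)"
      using \<open>\<And>i. 2 \<le> i \<Longrightarrow> i \<notin> F \<Longrightarrow> x' i u = 0\<close>[OF i] linear_diff[OF bounded_linear.linear[OF bl[OF i(1)]], of v u]
      by simp
    then have "norm (x' i v) \<le> C * norm (v - u)" using C[OF i(1)] by simp
    also have "\<dots> < e" using u(2) \<open>C > 0\<close> by (simp add: dist_norm norm_minus_commute field_simps)
    finally show ?thesis .
  qed
  then have "{i. 2 \<le> i \<and> e \<le> norm (x' i v)} \<subseteq> F" by (metis (no_types, lifting) linorder_not_le mem_Collect_eq subsetI)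
  then show ?thesis using F(2) finite_subset by blast
qed

lemma greedy_ordering_exists:
  assumes "fundamental x" "biorthogonal x x'" "bounded_functionals x'"
  shows "\<exists>\<rho>. greedy_ordering x' v \<rho>"
proof -
  define c where "c i = norm (x' i v)" for i
  have fin: "finite {i. 2 \<le> i \<and> e \<le> c i}" if "e > 0" for e
    unfolding c_def by (rule finite_large_coefficients[OF assms that])
  define P where "P S i \<longleftrightarrow> 2 \<le> i \<and> i \<notin> S \<and> (\<forall>j. 2 \<le> j \<and> j \<notin> S \<longrightarrow> c j \<le> c i)" for S i
  have exP: "\<exists>i. P S i" if "finite S" for S
  proof (cases "\<exists>k. 2 \<le> k \<and> k \<notin> S \<and> c k > 0")
    case True
    then obtain k where k: "2 \<le> k" "k \<notin> S" "c k > 0" by blast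
    define T where "T = {i. 2 \<le> i \<and> c k \<le> c i} - S"
    have T: "finite T" "T \<noteq> {}" using fin[OF k(3)] k by (auto simp: T_def)
    have "Max (c ` T) \<in> c ` T" using T by (intro Max_in) auto
    then obtain i where i: "i \<in> T" "c i = Max (c ` T)" by auto
    have i_max: "c j \<le> c i" if "j \<in> T" for j
      unfolding i(2) using T(1) that by (intro Max_ge) auto
    have "c j \<le> c i" if "2 \<le> j" "j \<notin> S" for j
    proof (cases "c k \<le> c j")
      case True then show ?thesis using i_max[of j] that by (simp add: T_def)
    next
      case False then show ?thesis using i(1) by (simp add: T_def)
    qed
    then show ?thesis using i(1) by (auto simp: P_def T_def)
  next
    case False
    have "infinite ({2::nat..} - S)" using that infinite_Ici by (rule Diff_infinite_finite)
    then obtain i where "i \<in> {2..} - S" by (metis finite.emptyI ex_in_conv)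
    moreover have "0 \<le> c i" by (simp add: c_def)
    ultimately show ?thesis using False by (intro exI[of _ i]) (auto simp: P_def intro: order_trans leI)
  qed
  define g where "g S = (LEAST i. P S i)" for S
  define S where "S n = ((\<lambda>S. insert (g S) S) ^^ n) {}" for n
  have S0: "S 0 = {}" and SSuc: "S (Suc n) = insert (g (S n)) (S n)" for n
    by (simp_all add: S_def)
  have finS: "finite (S n)" for n by (induction n) (simp_all add: S0 SSuc)
  have Pg: "P (S n) (g (S n))" for n unfolding g_def using exP[OF finS] by (rule LeastI_ex)
  have least: "g (S n) \<le> i" if "P (S n) i" for n i unfolding g_def using that by (rule Least_le)
  have monoS: "S n \<subseteq> S m" if "n \<le> m" for n m
    using that by (induction m rule: dec_induct) (auto simp: SSuc)
  have notin: "g (S m) \<notin> S n" if "n \<le> m" for n m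
    using Pg[of m] monoS[OF that] by (auto simp: P_def)
  have neq: "g (S m) \<noteq> g (S n)" if "n < m" for n m
    using notin[of "Suc n" m] that by (simp add: SSuc)
  have dec: "c (g (S m)) \<le> c (g (S n))" if "n \<le> m" for n m
    using Pg[of n] Pg[of m] notin[OF that] by (auto simp: P_def)
  have tie: "g (S n) < g (S m)" if "n < m" "c (g (S n)) = c (g (S m))" for n m
  proof -
    have "P (S n) (g (S m))"
      using Pg[of n] Pg[of m] notin[of n m] that by (auto simp: P_def)
    then show ?thesis using least[of n] neq[OF that(1)] by (metis le_neq_implies_less)
  qed
  define \<rho> where "\<rho> n = g (S (n - 1))" for n
  have inj: "inj_on \<rho> {1..}"
  proof (rule linorder_inj_onI)
    fix n m :: nat assume "n < m" "n \<in> {1..}" "m \<in> {1..}"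
    then have "n - 1 < m - 1" by auto
    then show "\<rho> n \<noteq> \<rho> m" using neq by (metis \<rho>_def)
  qed auto
  have rng: "\<rho> ` {1..} \<subseteq> {2..}" using Pg by (auto simp: \<rho>_def P_def)
  have "k \<in> \<rho> ` {1..}" if k: "k \<in> supp x' v" for k
  proof (rule ccontr)
    assume nk: "k \<notin> \<rho> ` {1..}"
    have k2: "2 \<le> k" "c k > 0" using k by (auto simp: supp_def c_def)
    have g_ne: "g (S n) \<noteq> k" for n
      using nk by (metis \<rho>_def atLeast_iff diff_Suc_1 image_eqI le_add1 plus_1_eq_Suc)
    have "k \<notin> S n" for n by (induction n) (use g_ne in \<open>auto simp: S0 SSuc\<close>)
    then have "c k \<le> c (g (S n))" for n using Pg[of n] k2 by (auto simp: P_def)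
    then have "\<rho> ` {1..} \<subseteq> {i. 2 \<le> i \<and> c k \<le> c i}" using rng by (auto simp: \<rho>_def)
    then have "finite (\<rho> ` {1..})" using fin[OF k2(2)] finite_subset by blast
    then show False using inj finite_imageD infinite_Ici by blast
  qed
  then have "greedy_ordering x' v \<rho>"
    using inj rng dec tie
    by (auto simp: greedy_ordering_def \<rho>_def c_def[symmetric] diff_le_mono diff_less_mono)
  then show ?thesis by blast
qed

end


section \<open>The space $c_0$\<close>

text \<open>
  Null sequences indexed by the positive integers: coordinate 0 is a dummy that is required to vanish.
\<close>

typedef (overloaded) 'k c0 = "{f :: nat \<Rightarrow> 'k::real_normed_vector. f \<longlonglongrightarrow> 0 \<and> f 0 = 0}"
  morphisms coord c0_of
  by (rule exI[of _ "\<lambda>_. 0"]) simp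

setup_lifting type_definition_c0

lemma coord_tendsto: "coord f \<longlonglongrightarrow> 0" and coord_0 [simp]: "coord f 0 = 0"
  using coord[of f] by auto

lemma c0_eqI: "(\<And>n. coord f n = coord g n) \<Longrightarrow> f = g"
  by (simp add: coord_inject[symmetric] ext)

lemma bdd_above_norm_coord: "bdd_above (range (\<lambda>n. norm (coord f n)))"
proof -
  have "Bseq (coord f)" using coord_tendsto by (intro convergent_imp_Bseq convergentI)
  then show ?thesis by (auto simp: Bseq_def bdd_above_def)
qed

instantiation c0 :: (real_normed_vector) real_normed_vector
begin

lift_definition zero_c0 :: "'a c0" is "\<lambda>_. 0" by simp
lift_definition plus_c0 :: "'a c0 \<Rightarrow> 'a c0 \<Rightarrow> 'a c0" is "\<lambda>f g n. f n + g n"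
  using tendsto_add by fastforce
lift_definition minus_c0 :: "'a c0 \<Rightarrow> 'a c0 \<Rightarrow> 'a c0" is "\<lambda>f g n. f n - g n"
  using tendsto_diff by fastforce
lift_definition uminus_c0 :: "'a c0 \<Rightarrow> 'a c0" is "\<lambda>f n. - f n"
  using tendsto_minus by fastforce
lift_definition scaleR_c0 :: "real \<Rightarrow> 'a c0 \<Rightarrow> 'a c0" is "\<lambda>r f n. r *\<^sub>R f n"
  using tendsto_scaleR[OF tendsto_const] by fastforce
lift_definition norm_c0 :: "'a c0 \<Rightarrow> real" is "\<lambda>f. SUP n. norm (f n)" .

definition dist_c0 :: "'a c0 \<Rightarrow> 'a c0 \<Rightarrow> real" where
  "dist_c0 f g = norm (f - g)"
definition sgn_c0 :: "'a c0 \<Rightarrow> 'a c0" where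
  "sgn_c0 f = scaleR (inverse (norm f)) f"
definition uniformity_c0 :: "('a c0 \<times> 'a c0) filter" where
  "uniformity_c0 = (INF e\<in>{0<..}. principal {(x, y). dist x y < e})"
definition open_c0 :: "'a c0 set \<Rightarrow> bool" where
  "open_c0 U = (\<forall>x\<in>U. \<forall>\<^sub>F (x', y) in uniformity. x' = x \<longrightarrow> y \<in> U)"

lemma norm_coord_le: "norm (coord f n) \<le> norm f"
  unfolding norm_c0.rep_eq by (rule cSUP_upper[OF UNIV_I bdd_above_norm_coord])

lemma norm_c0_le: "(\<And>n. norm (coord f n) \<le> b) \<Longrightarrow> norm f \<le> b"
  unfolding norm_c0.rep_eq by (rule cSUP_least) auto

instance
proof
  fix f g h :: "'a c0" and r s :: real
  show "f + g + h = f + (g + h)" by transfer (simp add: add.assoc)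
  show "f + g = g + f" by transfer (simp add: add.commute)
  show "0 + f = f" by transfer simp
  show "- f + f = 0" by transfer simp
  show "f - g = f + - g" by transfer simp
  show "r *\<^sub>R (f + g) = r *\<^sub>R f + r *\<^sub>R g" by transfer (simp add: scaleR_add_right)
  show "(r + s) *\<^sub>R f = r *\<^sub>R f + s *\<^sub>R f" by transfer (simp add: scaleR_add_left)
  show "r *\<^sub>R s *\<^sub>R f = (r * s) *\<^sub>R f" by transfer simp
  show "1 *\<^sub>R f = f" by transfer simp
  show "(norm f = 0) = (f = 0)"
  proof
    assume "norm f = 0"
    then have "coord f n = 0" for n using norm_coord_le[of f n] by simp
    then show "f = 0" by (intro c0_eqI) (simp add: zero_c0.rep_eq)
  qed (simp add: norm_c0.rep_eq zero_c0.rep_eq)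
  show "norm (f + g) \<le> norm f + norm g"
    by (rule norm_c0_le) (metis add_mono norm_coord_le norm_triangle_le plus_c0.rep_eq)
  have le: "norm (r *\<^sub>R f) \<le> \<bar>r\<bar> * norm f" for r and f :: "'a c0"
    by (rule norm_c0_le) (simp add: scaleR_c0.rep_eq mult_left_mono norm_coord_le)
  show "norm (r *\<^sub>R f) = \<bar>r\<bar> * norm f"
  proof (cases "r = 0")
    case True
    have "0 *\<^sub>R f = 0" by transfer simp
    then show ?thesis using True by (simp add: norm_c0.rep_eq zero_c0.rep_eq)
  next
    case False
    have "inverse r *\<^sub>R r *\<^sub>R f = f" using False by transfer simp
    then have "norm f \<le> \<bar>inverse r\<bar> * norm (r *\<^sub>R f)" using le[of "inverse r" "r *\<^sub>R f"] by simp
    then have "\<bar>r\<bar> * norm f \<le> norm (r *\<^sub>R f)" using False by (simp add: field_simps)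
    then show ?thesis using le[of r f] by simp
  qed
qed (rule dist_c0_def sgn_c0_def uniformity_c0_def open_c0_def)+

end

instance c0 :: ("{real_normed_vector, complete_space}") banach
proof
  fix X :: "nat \<Rightarrow> 'a c0"
  assume X: "Cauchy X"
  have le: "dist (coord f n) (coord g n) \<le> dist f g" for f g :: "'a c0" and n
    using norm_coord_le[of "f - g" n] by (simp add: dist_norm minus_c0.rep_eq)
  have "Cauchy (\<lambda>k. coord (X k) n)" for n
    using X le unfolding Cauchy_def by (meson order_le_less_trans)
  then have "\<exists>l. (\<lambda>k. coord (X k) n) \<longlonglongrightarrow> l" for n
    using Cauchy_convergent convergent_def by blast
  then obtain l where l: "\<And>n. (\<lambda>k. coord (X k) n) \<longlonglongrightarrow> l n" by metis
  have unif: "\<exists>K. \<forall>k\<ge>K. \<forall>n. dist (coord (X k) n) (l n) \<le> e" if "e > 0" for e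
  proof -
    obtain K where K: "\<And>k j. k \<ge> K \<Longrightarrow> j \<ge> K \<Longrightarrow> dist (X k) (X j) < e"
      using X \<open>e > 0\<close> unfolding Cauchy_def by meson
    have "dist (coord (X k) n) (l n) \<le> e" if "k \<ge> K" for k n
    proof (rule Lim_bounded[of _ _ K])
      show "(\<lambda>j. dist (coord (X k) n) (coord (X j) n)) \<longlonglongrightarrow> dist (coord (X k) n) (l n)"
        by (intro tendsto_intros l)
      show "\<forall>j\<ge>K. dist (coord (X k) n) (coord (X j) n) \<le> e"
        using K[OF that] le order_trans less_imp_le by meson
    qed
    then show ?thesis by blast
  qed
  have "l \<longlonglongrightarrow> 0"
  proof (rule metric_LIMSEQ_I)
    fix e :: real assume "e > 0"
    then obtain k where k: "\<And>n. dist (coord (X k) n) (l n) \<le> e / 2"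
      using unif[of "e / 2"] by auto
    obtain N where N: "\<And>n. n \<ge> N \<Longrightarrow> dist (coord (X k) n) 0 < e / 2"
      using metric_LIMSEQ_D[OF coord_tendsto, of "e / 2" "X k"] \<open>e > 0\<close> by auto
    have "dist (l n) 0 < e" if "n \<ge> N" for n
      using k[of n] N[OF that] dist_triangle[of "l n" 0 "coord (X k) n"] by (simp add: dist_commute)
    then show "\<exists>N. \<forall>n\<ge>N. dist (l n) 0 < e" by blast
  qed
  moreover have "l 0 = 0" using l[of 0] by (simp add: LIMSEQ_const_iff)
  ultimately have L: "coord (c0_of l) = l" by (simp add: c0_of_inverse)
  have "X \<longlonglongrightarrow> c0_of l"
  proof (rule metric_LIMSEQ_I)
    fix e :: real assume "e > 0"
    then obtain K where K: "\<And>k n. k \<ge> K \<Longrightarrow> dist (coord (X k) n) (l n) \<le> e / 2"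
      using unif[of "e / 2"] by auto
    have "dist (X k) (c0_of l) \<le> e / 2" if "k \<ge> K" for k
      unfolding dist_norm by (rule norm_c0_le) (metis K[OF that] L dist_norm minus_c0.rep_eq)
    then show "\<exists>K. \<forall>k\<ge>K. dist (X k) (c0_of l) < e" using \<open>e > 0\<close>
      by (intro exI[of _ K]) force
  qed
  then show "convergent X" by (rule convergentI)
qed

lift_definition c0_scale :: "'k::real_normed_field \<Rightarrow> 'k c0 \<Rightarrow> 'k c0" is "\<lambda>c f n. c * f n"
  using tendsto_mult_right_zero by fastforce

text \<open>The unit vectors \<open>e\<^sub>i\<close>, meaningful for \<open>i \<ge> 1\<close>.\<close>

lift_definition c0_unit :: "nat \<Rightarrow> 'k::real_normed_field c0"
  is "\<lambda>i n. if n = i \<and> 1 \<le> i then 1 else 0"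
proof -
  fix i :: nat
  have "\<forall>\<^sub>F n in sequentially. (if n = i \<and> 1 \<le> i then 1 else 0 :: 'k) = 0"
    using eventually_gt_at_top[of i] by eventually_elim simp
  then show "(\<lambda>n. if n = i \<and> 1 \<le> i then 1 else 0 :: 'k) \<longlonglongrightarrow> 0 \<and> (if 0 = i \<and> 1 \<le> i then 1 else 0 :: 'k) = 0"
    using tendsto_eventually by auto
qed

definition c0_functional :: "nat \<Rightarrow> 'k::real_normed_field c0 \<Rightarrow> 'k" where
  "c0_functional i f = coord f i"

global_interpretation c0:
  banach_space_over "c0_scale :: 'k::{real_normed_field, heine_borel} \<Rightarrow> 'k c0 \<Rightarrow> 'k c0"
proof unfold_locales
  fix a b :: 'k and f g :: "'k c0" and r :: real
  show "c0_scale a (f + g) = c0_scale a f + c0_scale a g" by transfer (simp add: distrib_left)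
  show "c0_scale (a + b) f = c0_scale a f + c0_scale b f" by transfer (simp add: distrib_right)
  show "c0_scale a (c0_scale b f) = c0_scale (a * b) f" by transfer (simp add: mult.assoc)
  show "c0_scale 1 f = f" by transfer simp
  show "c0_scale (of_real r) f = r *\<^sub>R f" by transfer (simp add: scaleR_conv_of_real)
  have le: "norm (c0_scale a f) \<le> norm a * norm f" for a and f :: "'k c0"
    by (rule norm_c0_le) (simp add: c0_scale.rep_eq norm_mult mult_left_mono norm_coord_le)
  show "norm (c0_scale a f) = norm a * norm f"
  proof (cases "a = 0")
    case True
    have "c0_scale 0 f = 0" by transfer simp
    then show ?thesis using True by simp
  next
    case False
    have "c0_scale (inverse a) (c0_scale a f) = f"
      using False by transfer (simp add: mult.assoc[symmetric])
    then have "norm f \<le> norm (inverse a) * norm (c0_scale a f)"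
      using le[of "inverse a" "c0_scale a f"] by simp
    then have "norm a * norm f \<le> norm a * (norm (inverse a) * norm (c0_scale a f))"
      by (intro mult_left_mono) auto
    also have "\<dots> = norm (c0_scale a f)"
      using False by (simp add: norm_inverse)
    finally have "norm a * norm f \<le> norm (c0_scale a f)" .
    then show ?thesis using le[of a f] by simp
  qed
qed

end

theory Submission
  imports Defs
begin

text \<open>
  The first coordinate is invisible to the functionals \<open>x' i\<close>, yet the vectors \<open>x i\<close> can adjust it with
  either sign. Everything follows from solving one finite-dimensional approximation problem exactly.
  For a finite set \<open>W\<close> of \<open>m\<close> indices, every \<open>z\<close> in the span of \<open>{x i |i. i \<in> W}\<close> satisfies
  \<open>z\<^sub>1 = (\<Sum>i\<in>W. (-1)^i z\<^sub>i)\<close>; let the defect \<open>D(W, v)\<close> of \<open>v\<close> be the difference of the two sides for \<open>v\<close>.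
  The defect is unchanged when \<open>v\<close> is replaced by \<open>v - z\<close> and involves \<open>m + 1\<close> coordinates, so
  the error satisfies both \<open>\<bar>D(W, v)\<bar> \<le> (m + 1) \<parallel>v - z\<parallel>\<close> and \<open>\<bar>v\<^sub>j\<bar> \<le> \<parallel>v - z\<parallel>\<close> for
  \<open>j \<ge> 2\<close> outside \<open>W\<close> (\<open>approximation_error_ge\<close>). Distributing the defect evenly over the \<open>m + 1\<close>
  coordinates attains the resulting lower bound (\<open>best_error_le\<close>).

  Fundamentality: for \<open>W = {2..n+1}\<close> the best error tends to \<open>0\<close>, because \<open>D(W, v) / (n + 1)\<close> is
  dominated by an average of a null sequence. Since \<open>e\<^sub>1\<close> is annihilated by all functionals, and
  these are the only ones that are biorthogonal, the system is not a Markushevich basis. Even indices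
  all push the first coordinate in the same direction, while consecutive indices cancel; this
  refutes quasi-greediness and democracy.

  Semi-greediness: let \<open>W\<close> be an \<open>m\<close>-weak thresholding set and \<open>y\<close> a combination of the
  vectors over an index set \<open>B\<close> with at most \<open>m\<close> elements, and put \<open>t = \<parallel>v - y\<parallel> / \<tau>\<close>. The coordinates of \<open>v\<close>
  outside \<open>B\<close> are at most \<open>t\<close>, and by thresholding so are those outside \<open>W\<close>.
  Passing from \<open>D(B, v)\<close>, which is at most \<open>(m + 1) t\<close>, to \<open>D(W, v)\<close> changes at most \<open>2m\<close> terms, each
  of modulus at most \<open>t\<close>. So \<open>\<bar>D(W, v)\<bar> \<le> (3m + 1) t \<le> 3 (m + 1) t\<close>, and the best error over \<open>W\<close> is at
  most \<open>3 t\<close> (\<open>thresholding_error_le\<close>). Greedy sets are the case \<open>\<tau> = 1\<close>. As best approximations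
  are attained, the semi-greedy constants form a closed set, so a least one exists.
\<close>

section \<open>Biorthogonal functionals and thresholding sets\<close>

text \<open>
  Two biorthogonal sequences agree on the linear span by linearity, hence on its closure by
  continuity.
\<close>

lemma (in banach_space_over) biorthogonal_unique:
  assumes "fundamental x" "biorthogonal x f" "biorthogonal x g" "2 \<le> i"
  shows "f i v = g i v"
proof -
  have dual: "f i \<in> dual" "g i \<in> dual"
    using assms(2-4) by (auto simp: biorthogonal_def)
  interpret pair: vector_space_pair scale "(*)"
    by unfold_locales (auto simp: algebra_simps)
  have "f i u = g i u" if "u \<in> span (x ` {2..})" for u
    by (rule pair.linear_eq_on_span[of "f i" "g i" "x ` {2..}"])
       (use dual that assms(2-4) in \<open>auto simp: dual_def biorthogonal_def\<close>)
  then have "span (x ` {2..}) \<subseteq> {u. f i u = g i u}" by blast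
  moreover have "closed {u. f i u = g i u}"
    using dual by (intro closed_Collect_eq) (auto simp: dual_def)
  ultimately have "closure (span (x ` {2..})) \<subseteq> {u. f i u = g i u}"
    by (rule closure_minimal)
  then show ?thesis
    using assms(1) by (auto simp: fundamental_def)
qed

lemma (in banach_space_over) proj_in_span: "proj x x' A v \<in> span (x ` A)"
  unfolding proj_def by (intro span_sum span_scale span_base) auto

text \<open>
  An index that comes later in the ordering has no larger coefficient, and one that the ordering
  misses altogether lies outside the support and has coefficient zero.
\<close>

lemma (in banach_space_over) greedy_set_weak_thresholding:
  assumes "greedy_ordering x' v \<rho>"
  shows "weak_thresholding_set x' 1 v m (greedy_set \<rho> m)"
proof -
  have inj: "inj_on \<rho> {1..}" and rng: "\<rho> ` {1..} \<subseteq> {2..}"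
    and supp: "supp x' v \<subseteq> \<rho> ` {1..}"
    and dec: "\<And>i j. 1 \<le> i \<Longrightarrow> i \<le> j \<Longrightarrow> norm (x' (\<rho> j) v) \<le> norm (x' (\<rho> i) v)"
    using assms by (auto simp: greedy_ordering_def)
  have "norm (x' j v) \<le> norm (x' (\<rho> i) v)"
    if i: "i \<in> {1..m}" and j: "2 \<le> j" "j \<notin> greedy_set \<rho> m" for i j
  proof (cases "j \<in> supp x' v")
    case True
    then obtain k where k: "1 \<le> k" "j = \<rho> k" using supp by auto
    with j have "m < k" by (force simp: greedy_set_def)
    then show ?thesis using i k dec[of i k] by auto
  next
    case False
    then show ?thesis using j(1) by (simp add: supp_def)
  qed
  moreover have "card (greedy_set \<rho> m) = m"
    unfolding greedy_set_def by (subst card_image) (auto intro: inj_on_subset[OF inj])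
  moreover have "greedy_set \<rho> m \<subseteq> {2..}" "finite (greedy_set \<rho> m)"
    using rng by (auto simp: greedy_set_def image_subset_iff)
  ultimately show ?thesis
    by (auto simp: weak_thresholding_set_def greedy_set_def simp del: One_nat_def)
qed

text \<open>
  If an index outside the support were chosen, then by cardinality one in the support would be left
  out, and its nonzero coefficient would be dominated by zero. In particular, the
  greedy set of the size of the support is the same for all admissible orderings.
\<close>

lemma (in banach_space_over) weak_thresholding_set_eq_supp:
  assumes W: "weak_thresholding_set x' \<tau> v m W" and "0 < \<tau>"
    and supp: "finite (supp x' v)" "card (supp x' v) = m"
  shows "W = supp x' v"
proof -
  have W': "W \<subseteq> {2..}" "finite W" "card W = m"
    using W by (auto simp: weak_thresholding_set_def)
  have "W \<subseteq> supp x' v"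
  proof
    fix i assume "i \<in> W"
    show "i \<in> supp x' v"
    proof (rule ccontr)
      assume i: "i \<notin> supp x' v"
      have "\<not> supp x' v \<subseteq> W"
        using \<open>i \<in> W\<close> i supp W' card_subset_eq[of W "supp x' v"] by auto
      then obtain j where j: "j \<in> supp x' v" "j \<notin> W" by blast
      then have "\<tau> * norm (x' j v) \<le> norm (x' i v)"
        using W \<open>i \<in> W\<close> by (auto simp: weak_thresholding_set_def supp_def)
      also have "\<dots> = 0" using i \<open>i \<in> W\<close> W'(1) by (auto simp: supp_def)
      finally show False
        using j(1) \<open>0 < \<tau>\<close> by (auto simp: supp_def mult_le_0_iff)
    qed
  qed
  then show ?thesis using supp W' card_subset_eq by blast
qed

section \<open>Coordinates in c0\<close>

lemma coord_sum: "coord (sum f A) n = (\<Sum>i\<in>A. coord (f i) n)"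
  by (induction A rule: infinite_finite_induct) (simp_all add: zero_c0.rep_eq plus_c0.rep_eq)

lemma norm_c0_le_coords:
  assumes "norm (coord f 1) \<le> b" "\<And>n. 2 \<le> n \<Longrightarrow> norm (coord f n) \<le> b"
  shows "norm f \<le> b"
proof (rule norm_c0_le)
  fix n :: nat
  have "0 \<le> b" using assms(1) norm_ge_zero order_trans by blast
  consider "n = 0" | "n = 1" | "2 \<le> n" by linarith
  then show "norm (coord f n) \<le> b"
    by cases (use assms \<open>0 \<le> b\<close> in auto)
qed

lemma coord_functional_dual: "c0_functional i \<in> c0.dual"
proof -
  have "Vector_Spaces.linear c0_scale (*) (c0_functional i :: 'a::{real_normed_field, heine_borel} c0 \<Rightarrow> 'a)"
    by unfold_locales
       (simp_all add: c0_functional_def plus_c0.rep_eq c0_scale.rep_eq algebra_simps)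
  moreover have "continuous_on UNIV (c0_functional i :: 'a c0 \<Rightarrow> 'a)"
  proof (rule linear_continuous_on)
    show "bounded_linear (c0_functional i :: 'a c0 \<Rightarrow> 'a)"
      by (rule bounded_linear_intro[where K = 1])
         (simp_all add: c0_functional_def plus_c0.rep_eq scaleR_c0.rep_eq norm_coord_le)
  qed
  ultimately show ?thesis by (simp add: c0.dual_def)
qed

section \<open>The alternating system\<close>

locale alternating_system =
  fixes x :: "nat \<Rightarrow> 'k::{real_normed_field, heine_borel} c0"
    and x' :: "nat \<Rightarrow> 'k c0 \<Rightarrow> 'k"
  assumes x_eq: "\<And>i. 2 \<le> i \<Longrightarrow> x i = c0_unit i + c0_scale ((-1) ^ i) (c0_unit 1)"
    and x'_eq: "\<And>i. 2 \<le> i \<Longrightarrow> x' i = c0_functional i"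
begin

lemma coord_x:
  assumes "2 \<le> i"
  shows "coord (x i) 1 = (-1) ^ i" "2 \<le> n \<Longrightarrow> coord (x i) n = (if n = i then 1 else 0)"
  using assms by (auto simp: x_eq plus_c0.rep_eq c0_scale.rep_eq c0_unit.rep_eq)

lemma x'_coord: "2 \<le> i \<Longrightarrow> x' i v = coord v i"
  by (simp add: x'_eq c0_functional_def)

lemma coord_combination:
  assumes "A \<subseteq> {2..}" "finite A"
  shows "coord (\<Sum>i\<in>A. c0_scale (b i) (x i)) 1 = (\<Sum>i\<in>A. (-1) ^ i * b i)"
    and "2 \<le> n \<Longrightarrow> coord (\<Sum>i\<in>A. c0_scale (b i) (x i)) n = (if n \<in> A then b n else 0)"
proof -
  have A: "2 \<le> i" if "i \<in> A" for i using that assms(1) by auto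
  show "coord (\<Sum>i\<in>A. c0_scale (b i) (x i)) 1 = (\<Sum>i\<in>A. (-1) ^ i * b i)"
    unfolding coord_sum
    by (intro sum.cong refl) (use A in \<open>simp add: c0_scale.rep_eq coord_x[simplified]\<close>)
  assume "2 \<le> n"
  have "(\<Sum>i\<in>A. coord (c0_scale (b i) (x i)) n) = (\<Sum>i\<in>A. if n = i then b i else 0)"
    by (intro sum.cong refl) (use A \<open>2 \<le> n\<close> in \<open>auto simp: c0_scale.rep_eq coord_x\<close>)
  then show "coord (\<Sum>i\<in>A. c0_scale (b i) (x i)) n = (if n \<in> A then b n else 0)"
    using assms(2) by (simp add: coord_sum)
qed

lemma biorthogonal: "c0.biorthogonal x x'"
  by (auto simp: c0.biorthogonal_def x'_eq coord_functional_dual)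
     (simp_all add: c0_functional_def coord_x)

lemma bounded: "c0.bounded_functionals x'"
  unfolding c0.bounded_functionals_def bdd_above_def
  by (intro exI[of _ 1] ballI, elim imageE)
     (auto simp: x'_eq c0_functional_def norm_coord_le intro!: onorm_bound)


section \<open>Best approximation from finitely many of the vectors\<close>

text \<open>
  The obstruction to \<open>v\<close> agreeing with a combination of the vectors indexed by \<open>W\<close> on the
  coordinates in \<open>insert 1 W\<close>.
\<close>

definition defect :: "nat set \<Rightarrow> 'k c0 \<Rightarrow> 'k" where
  "defect W v = coord v 1 - (\<Sum>i\<in>W. (-1) ^ i * coord v i)"

lemma defect_add: "defect W (u + v) = defect W u + defect W v"
  by (simp add: defect_def plus_c0.rep_eq sum.distrib algebra_simps)

lemma defect_diff: "defect W (u - v) = defect W u - defect W v"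
  by (simp add: defect_def minus_c0.rep_eq sum_subtractf algebra_simps)

lemma defect_scale: "defect W (c0_scale c v) = c * defect W v"
  by (simp add: defect_def c0_scale.rep_eq sum_distrib_left algebra_simps)

lemma norm_defect_le: "norm (defect W v) \<le> (real (card W) + 1) * norm v"
proof -
  have "norm (defect W v) \<le> norm (coord v 1) + norm (\<Sum>i\<in>W. (-1) ^ i * coord v i)"
    unfolding defect_def by (rule norm_triangle_ineq4)
  also have "norm (\<Sum>i\<in>W. (-1) ^ i * coord v i) \<le> real (card W) * norm v"
    by (rule sum_norm_bound) (simp add: norm_mult norm_power norm_coord_le)
  also have "norm (coord v 1) \<le> norm v" by (rule norm_coord_le)
  finally show ?thesis by (simp add: algebra_simps)
qed

lemma span_defect:
  assumes W: "W \<subseteq> {2..}" "finite W" and z: "z \<in> c0.span (x ` W)"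
  shows "defect W z = 0 \<and> (\<forall>j\<in>{2..} - W. coord z j = 0)"
  using z
proof (rule c0.span_induct_alt)
  show "defect W 0 = 0 \<and> (\<forall>j\<in>{2..} - W. coord 0 j = 0)"
    by (simp add: defect_def zero_c0.rep_eq)
next
  fix c s y
  assume "s \<in> x ` W" and y: "defect W y = 0 \<and> (\<forall>j\<in>{2..} - W. coord y j = 0)"
  then obtain i where i: "i \<in> W" "2 \<le> i" "s = x i" using W by auto
  have "(\<Sum>k\<in>W. (-1) ^ k * coord (x i) k) = (\<Sum>k\<in>W. if k = i then (-1) ^ k else 0)"
    by (intro sum.cong refl) (use W i in \<open>auto simp: coord_x\<close>)
  then have "defect W s = 0"
    using W i by (simp add: defect_def coord_x[simplified])
  then show "defect W (c0_scale c s + y) = 0 \<and> (\<forall>j\<in>{2..} - W. coord (c0_scale c s + y) j = 0)"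
    using y i by (auto simp: defect_add defect_scale plus_c0.rep_eq c0_scale.rep_eq coord_x)
qed

text \<open>
  Subtracting \<open>z\<close> from \<open>v\<close> changes neither the defect nor the coordinates outside \<open>insert 1 W\<close>, so both
  can be read off from \<open>v - z\<close>.
\<close>

lemma approximation_error_ge:
  assumes "W \<subseteq> {2..}" "finite W" "z \<in> c0.span (x ` W)"
  shows "norm (defect W v) \<le> (real (card W) + 1) * norm (v - z)"
    and "j \<in> {2..} - W \<Longrightarrow> norm (coord v j) \<le> norm (v - z)"
  using span_defect[OF assms] norm_defect_le[of W "v - z"] norm_coord_le[of "v - z" j]
  by (auto simp: defect_diff minus_c0.rep_eq)

text \<open>
  Taking the coefficients \<open>v\<^sub>i\<close> would put the whole defect into the first coordinate. The correction
  term splits it into \<open>card W + 1\<close> parts of equal modulus, one for coordinate 1 and one for each index in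
  \<open>W\<close>.
\<close>

definition best_coeff :: "nat set \<Rightarrow> 'k c0 \<Rightarrow> nat \<Rightarrow> 'k" where
  "best_coeff W v i = coord v i + (-1) ^ i * (defect W v / of_nat (card W + 1))"

definition best :: "nat set \<Rightarrow> 'k c0 \<Rightarrow> 'k c0" where
  "best W v = (\<Sum>i\<in>W. c0_scale (best_coeff W v i) (x i))"

lemma best_in_span: "best W v \<in> c0.span (x ` W)"
  unfolding best_def by (intro c0.span_sum c0.span_scale c0.span_base) auto

text \<open>
  The two hypotheses are the necessary conditions of \<open>approximation_error_ge\<close>, so \<open>best W v\<close>
  attains the distance of \<open>v\<close> from the span. It depends on \<open>v\<close> and \<open>W\<close> only, which later makes the bounds
  uniform over all competitors \<open>y\<close> in \<open>\<sigma>\<^sub>m(v)\<close>.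
\<close>

lemma best_error_le:
  assumes W: "W \<subseteq> {2..}" "finite W"
    and defect: "norm (defect W v) \<le> (real (card W) + 1) * r"
    and off: "\<And>j. j \<in> {2..} - W \<Longrightarrow> norm (coord v j) \<le> r"
  shows "norm (v - best W v) \<le> r"
proof -
  define d where "d = defect W v / of_nat (card W + 1)"
  have coeff: "best_coeff W v i = coord v i + (-1) ^ i * d" for i
    by (simp only: best_coeff_def d_def)
  have D: "defect W v = of_nat (card W) * d + d"
  proof -
    have "(of_nat (card W + 1) :: 'k) \<noteq> 0" by (simp only: of_nat_eq_0_iff)
    then have "defect W v = of_nat (card W + 1) * d"
      unfolding d_def by (metis nonzero_mult_div_cancel_left times_divide_eq_right)
    then show ?thesis by (simp add: algebra_simps)
  qed
  have norm_d: "norm d \<le> r"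
  proof -
    have "norm d = norm (defect W v) / (real (card W) + 1)"
      unfolding d_def norm_divide norm_of_nat by (simp add: add.commute)
    then show ?thesis using defect by (simp add: pos_divide_le_eq mult.commute)
  qed
  have sq: "(-1) ^ i * ((-1) ^ i * d) = d" for i
    by (simp add: mult.assoc[symmetric] flip: power_add)
  have "coord (best W v) 1 = (\<Sum>i\<in>W. (-1) ^ i * coord v i) + (\<Sum>i\<in>W. d)"
    unfolding best_def coord_combination[OF W]
    by (simp add: coeff distrib_left sq sum.distrib)
  then have "coord (v - best W v) 1 = d"
    using D by (simp add: minus_c0.rep_eq defect_def algebra_simps)
  moreover have "norm (coord (v - best W v) n) \<le> r" if "2 \<le> n" for n
  proof (cases "n \<in> W")
    case True
    then have "coord (v - best W v) n = - ((-1) ^ n * d)"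
      using that unfolding best_def
      by (simp add: minus_c0.rep_eq coord_combination[OF W] coeff)
    then show ?thesis using norm_d by (simp add: norm_mult norm_power)
  next
    case False
    then show ?thesis
      using that off unfolding best_def by (simp add: minus_c0.rep_eq coord_combination[OF W])
  qed
  ultimately show ?thesis
    using norm_d by (intro norm_c0_le_coords) auto
qed

lemma best_is_best:
  assumes "W \<subseteq> {2..}" "finite W" "z \<in> c0.span (x ` W)"
  shows "norm (v - best W v) \<le> norm (v - z)"
  using assms by (intro best_error_le approximation_error_ge)


section \<open>Fundamental, but not a Markushevich basis\<close>

text \<open>
  Approximate from the first \<open>n\<close> vectors. All but finitely many terms of the defect are smaller than
  \<open>d\<close>, so for large \<open>n\<close> the defect is at most \<open>2 n d\<close>, while it is shared by \<open>n + 1\<close> coordinates.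
\<close>

lemma fundamental: "c0.fundamental x"
proof -
  have "\<exists>u\<in>c0.span (x ` {2..}). dist u v < e" if "e > 0" for v and e :: real
  proof -
    define d where "d = e / 3"
    have "d > 0" using \<open>e > 0\<close> by (simp add: d_def)
    have "coord v \<longlonglongrightarrow> 0" by (rule coord_tendsto)
    then obtain N where N: "\<And>n. n \<ge> N \<Longrightarrow> norm (coord v n) < d"
      using \<open>d > 0\<close> LIMSEQ_D[of "coord v" 0 "d"] by auto
    define C where "C = norm (coord v 1) + (\<Sum>i<N. norm (coord v i))"
    obtain n where n: "real n > N" "real n > C / d"
      using reals_Archimedean2[of "max (real N) (C / d)"] by auto
    define W where "W = {2..n + 1}"
    have "C < real n * d" using n(2) \<open>d > 0\<close> by (simp add: divide_less_eq)
    have "norm (v - best W v) \<le> 2 * d"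
    proof (rule best_error_le)
      have sum: "(\<Sum>i\<in>W. norm (coord v i)) \<le> (\<Sum>i<N. norm (coord v i)) + real n * d"
      proof -
        have "(\<Sum>i\<in>W. norm (coord v i)) =
            (\<Sum>i\<in>W \<inter> {..<N}. norm (coord v i)) + (\<Sum>i\<in>W - {..<N}. norm (coord v i))"
          by (rule sum.Int_Diff) (simp add: W_def)
        also have "(\<Sum>i\<in>W \<inter> {..<N}. norm (coord v i)) \<le> (\<Sum>i<N. norm (coord v i))"
          by (rule sum_mono2) auto
        also have "(\<Sum>i\<in>W - {..<N}. norm (coord v i)) \<le> real (card (W - {..<N})) * d"
          using N by (intro sum_bounded_above) (auto simp: not_less intro: less_imp_le)
        also have "\<dots> \<le> real n * d"
          using \<open>d > 0\<close> card_mono[of W "W - {..<N}"] by (intro mult_right_mono) (auto simp: W_def)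
        finally show ?thesis by simp
      qed
      have "norm (defect W v) \<le> norm (coord v 1) + (\<Sum>i\<in>W. norm (coord v i))"
        unfolding defect_def
        by (rule order_trans[OF norm_triangle_ineq4], intro add_left_mono sum_norm_le)
           (simp add: norm_mult norm_power)
      also have "\<dots> \<le> C + real n * d" using sum by (simp add: C_def)
      also have "\<dots> \<le> (real (card W) + 1) * (2 * d)"
        using \<open>C < real n * d\<close> \<open>d > 0\<close> by (simp add: W_def algebra_simps)
      finally show "norm (defect W v) \<le> (real (card W) + 1) * (2 * d)" .
    next
      fix j assume "j \<in> {2..} - W"
      then have "norm (coord v j) < d" using n(1) by (intro N) (auto simp: W_def)
      then show "norm (coord v j) \<le> 2 * d" using \<open>d > 0\<close> by simp
    qed (auto simp: W_def)
    moreover have "best W v \<in> c0.span (x ` {2..})"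
      by (rule subsetD[OF c0.span_mono best_in_span]) (auto simp: W_def)
    ultimately show ?thesis
      using \<open>e > 0\<close>
      by (intro bexI[of _ "best W v"]) (auto simp: d_def dist_norm norm_minus_commute)
  qed
  then show ?thesis by (auto simp: c0.fundamental_def closure_approachable)
qed

text \<open>
  The vector \<open>e\<^sub>1\<close> is annihilated by every coordinate functional of index at least 2, hence, by
  uniqueness, by every biorthogonal sequence.
\<close>

lemma not_markushevich: "\<not> c0.markushevich_basis x"
proof
  assume "c0.markushevich_basis x"
  then obtain f where f: "c0.biorthogonal x f" "c0.total f"
    by (auto simp: c0.markushevich_basis_def)
  have "f i (c0_unit 1) = 0" if "2 \<le> i" for i
    using c0.biorthogonal_unique[OF fundamental f(1) biorthogonal that, of "c0_unit 1"] that
    by (simp add: x'_coord c0_unit.rep_eq)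
  then have "c0_unit 1 = (0 :: 'k c0)" using f(2) by (simp add: c0.total_def)
  then have "coord (c0_unit 1) 1 = coord (0 :: 'k c0) 1" by simp
  then show False by (simp add: c0_unit.rep_eq zero_c0.rep_eq)
qed


section \<open>Neither quasi-greedy nor democratic\<close>

definition evens :: "nat \<Rightarrow> nat set" where
  "evens n = (*) 2 ` {1..n}"

lemma evens: "evens n \<subseteq> {2..}" "finite (evens n)" "card (evens n) = n"
  by (auto simp: evens_def card_image inj_on_def)

text \<open>
  Even indices all add \<open>1\<close> to the first coordinate.
\<close>

lemma norm_sum_evens_ge: "real n \<le> norm (\<Sum>i\<in>evens n. x i)"
proof -
  have "coord (\<Sum>i\<in>evens n. x i) 1 = (\<Sum>i\<in>evens n. (-1) ^ i * 1)"
    using coord_combination(1)[OF evens(1,2), of "\<lambda>_. 1"] by simp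
  also have "\<dots> = (\<Sum>i\<in>evens n. 1)" by (intro sum.cong refl) (auto simp: evens_def)
  finally have "norm (coord (\<Sum>i\<in>evens n. x i) 1) = real n" using evens(3) by simp
  then show ?thesis using norm_coord_le by metis
qed

text \<open>
  The test vector is \<open>e\<^sub>2 + e\<^sub>4 + \<dots> + e\<^sub>2\<^sub>n\<close>, of norm at most \<open>1\<close>. Its support has \<open>n\<close> elements and so is its greedy set
  of size \<open>n\<close>, but reassembling its coefficients with the vectors \<open>x i\<close> adds \<open>n e\<^sub>1\<close>.
\<close>

lemma not_quasi_greedy: "\<not> c0.quasi_greedy x x'"
proof
  assume "c0.quasi_greedy x x'"
  then obtain M where M: "M > 0"
    "\<And>v m \<rho>. c0.greedy_ordering x' v \<rho> \<Longrightarrow> norm (c0.greedy_sum x x' \<rho> m v) \<le> M * norm v"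
    by (auto simp: c0.quasi_greedy_def)
  have "real n \<le> M" for n
  proof -
    define v :: "'k c0" where "v = (\<Sum>i\<in>evens n. c0_unit i)"
    have coord_v: "coord v k = (if k \<in> evens n then 1 else 0)" for k
    proof -
      have "coord v k = (\<Sum>i\<in>evens n. if k = i then 1 else 0)"
        unfolding v_def coord_sum
        by (intro sum.cong refl) (use evens(1)[of n] in \<open>auto simp: c0_unit.rep_eq\<close>)
      then show ?thesis using evens(2) by (simp add:)
    qed
    have supp: "c0.supp x' v = evens n"
      using evens(1)[of n] by (auto simp: c0.supp_def x'_coord coord_v split: if_splits)
    obtain \<rho> where \<rho>: "c0.greedy_ordering x' v \<rho>"
      using c0.greedy_ordering_exists[OF fundamental biorthogonal bounded] by blast
    have "c0.greedy_set \<rho> n = evens n"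
      using c0.weak_thresholding_set_eq_supp[OF c0.greedy_set_weak_thresholding[OF \<rho>]] supp evens(2,3)
      by simp
    then have "c0.greedy_sum x x' \<rho> n v = (\<Sum>i\<in>evens n. c0_scale (x' i v) (x i))"
      by (simp add: c0.greedy_sum_def c0.proj_def)
    also have "\<dots> = (\<Sum>i\<in>evens n. x i)"
      by (intro sum.cong refl) (use evens(1)[of n] in \<open>auto simp: x'_coord coord_v\<close>)
    finally have "real n \<le> norm (c0.greedy_sum x x' \<rho> n v)"
      using norm_sum_evens_ge by simp
    also have "\<dots> \<le> M * norm v" by (rule M(2)[OF \<rho>])
    also have "\<dots> \<le> M * 1"
      using M(1) by (intro mult_left_mono norm_c0_le) (auto simp: coord_v)
    finally show ?thesis by simp
  qed
  then show False using reals_Archimedean2[of M] by (meson not_le)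
qed

text \<open>
  Over \<open>2n\<close> consecutive indices the contributions to the first coordinate cancel in pairs.
\<close>

lemma not_democratic: "\<not> c0.democratic x"
proof
  assume "c0.democratic x"
  then obtain K where K: "K > 0"
    "\<forall>A B. A \<subseteq> {2..} \<and> B \<subseteq> {2..} \<and> finite A \<and> finite B \<and> card A \<le> card B \<longrightarrow>
       norm (\<Sum>i\<in>A. x i) \<le> K * norm (\<Sum>j\<in>B. x j)"
    unfolding c0.democratic_def by (elim exE conjE)
  have "real n \<le> K" for n
  proof -
    define B :: "nat set" where "B = {2..<2 * n + 2}"
    have B: "B \<subseteq> {2..}" "finite B" "card B = 2 * n" by (auto simp: B_def)
    have alt: "(\<Sum>i\<in>B. (-1) ^ i) = (0 :: 'k)"
      unfolding B_def by (induction n) simp_all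
    have "norm (\<Sum>j\<in>B. x j) \<le> 1"
      using coord_combination[OF B(1,2), where b = "\<lambda>_. 1"] alt
      by (intro norm_c0_le_coords) auto
    then have "K * norm (\<Sum>j\<in>B. x j) \<le> K * 1" using K(1) by (intro mult_left_mono) auto
    moreover have "norm (\<Sum>i\<in>evens n. x i) \<le> K * norm (\<Sum>j\<in>B. x j)"
      using evens B by (intro K(2)[rule_format]) auto
    ultimately show ?thesis using norm_sum_evens_ge[of n] by linarith
  qed
  then show False using reals_Archimedean2[of K] by (meson not_le)
qed


section \<open>Semi-greedy\<close>

text \<open>
  The heart of the semi-greedy estimate. If \<open>B\<close> has an element outside \<open>W\<close>, then, as \<open>card B \<le> card W\<close>, \<open>W\<close> has
  an element outside \<open>B\<close>; there \<open>v\<close> is bounded by \<open>\<parallel>v - y\<parallel>\<close>, and thresholding transfers this bound, at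
  the price of the factor \<open>1 / \<tau>\<close>, to all coordinates outside \<open>W\<close>. The constant \<open>3\<close> counts the
  three contributions to the defect over \<open>W\<close>: the defect over \<open>B\<close> and the terms in \<open>B - W\<close> and \<open>W - B\<close>.
\<close>

lemma thresholding_error_le:
  assumes \<tau>: "0 < \<tau>" "\<tau> \<le> 1" and W: "c0.weak_thresholding_set x' \<tau> v m W"
    and B: "B \<subseteq> {2..}" "finite B" "card B \<le> m" and y: "y \<in> c0.span (x ` B)"
  shows "norm (v - best W v) \<le> 3 * inverse \<tau> * norm (v - y)"
proof -
  define s where "s = norm (v - y)"
  define t where "t = inverse \<tau> * s"
  have W': "W \<subseteq> {2..}" "finite W" "card W = m"
    and thr: "\<And>i j. i \<in> W \<Longrightarrow> j \<in> {2..} - W \<Longrightarrow> \<tau> * norm (coord v j) \<le> norm (coord v i)"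
    using W by (force simp: c0.weak_thresholding_set_def x'_coord)+
  have "0 \<le> s" by (simp add: s_def)
  then have st: "s \<le> t" using \<tau> by (simp add: t_def field_simps mult_left_le_one_le)
  have off_B: "norm (coord v j) \<le> s" if "j \<in> {2..} - B" for j
    using approximation_error_ge(2)[OF B(1,2) y that] by (simp add: s_def)
  have off_W: "norm (coord v j) \<le> t" if j: "j \<in> {2..} - W" for j
  proof (cases "j \<in> B")
    case True
    have "\<not> W \<subseteq> B"
      using True j W' B(2,3) by (metis DiffD2 card_seteq)
    then obtain i where "i \<in> W" "i \<notin> B" by blast
    then have "\<tau> * norm (coord v j) \<le> s"
      using thr[OF _ j] off_B[of i] W'(1) by (meson Diff_iff order_trans subsetD)
    then show ?thesis using \<tau>(1) by (simp add: t_def field_simps)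
  next
    case False
    then show ?thesis using off_B[of j] j st by auto
  qed
  have "norm (v - best W v) \<le> 3 * t"
  proof (rule best_error_le[OF W'(1,2)])
    let ?f = "\<lambda>i. (-1) ^ i * coord v i"
    have "sum ?f B = sum ?f (B - W) + sum ?f (B \<inter> W)" "sum ?f W = sum ?f (W - B) + sum ?f (B \<inter> W)"
      using sum.Int_Diff[OF B(2), of ?f W] sum.Int_Diff[OF W'(2), of ?f B]
      by (simp_all add: Int_commute add.commute)
    then have "defect W v = defect B v + sum ?f (B - W) - sum ?f (W - B)"
      by (simp add: defect_def)
    then have "norm (defect W v) \<le> norm (defect B v) + norm (sum ?f (B - W)) + norm (sum ?f (W - B))"
      by (simp only:) (rule order_trans[OF norm_triangle_ineq4 add_right_mono[OF norm_triangle_ineq]])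
    also have "norm (sum ?f (B - W)) \<le> real (card (B - W)) * t"
      by (rule sum_norm_bound) (use off_W B(1) in \<open>auto simp: norm_mult norm_power\<close>)
    also have "real (card (B - W)) * t \<le> real m * t"
      using st \<open>0 \<le> s\<close> B card_mono[of B "B - W"] by (intro mult_right_mono) auto
    also have "norm (sum ?f (W - B)) \<le> real (card (W - B)) * t"
      by (rule sum_norm_bound)
         (use off_B W'(1) st in \<open>auto simp: norm_mult norm_power intro: order_trans\<close>)
    also have "real (card (W - B)) * t \<le> real m * t"
      using st \<open>0 \<le> s\<close> W' card_mono[of W "W - B"] by (intro mult_right_mono) auto
    also have "norm (defect B v) \<le> (real (card B) + 1) * s"
      using approximation_error_ge(1)[OF B(1,2) y] by (simp add: s_def)
    also have "\<dots> \<le> (real m + 1) * t"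
      using st \<open>0 \<le> s\<close> B(3) by (intro mult_mono) auto
    finally have "norm (defect W v) \<le> (real m + 1) * t + real m * t + real m * t" by simp
    also have "\<dots> \<le> (real (card W) + 1) * (3 * t)"
      using st \<open>0 \<le> s\<close> W'(3) by (simp add: algebra_simps)
    finally show "norm (defect W v) \<le> (real (card W) + 1) * (3 * t)" .
  next
    fix j assume "j \<in> {2..} - W"
    then show "norm (coord v j) \<le> 3 * t" using off_W[of j] st \<open>0 \<le> s\<close> by linarith
  qed
  then show ?thesis by (simp add: t_def s_def mult.assoc)
qed

lemma supp_0: "c0.supp x' (0 :: 'k c0) = {}"
  by (auto simp: c0.supp_def x'_coord zero_c0.rep_eq)

lemma sigma_0: "c0.sigma x x' 0 v = norm v"
proof -
  have "finite (c0.supp x' y) \<and> card (c0.supp x' y) \<le> 0 \<and> y = c0.proj x x' (c0.supp x' y) y \<longleftrightarrow> y = 0"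
    (is "?P y \<longleftrightarrow> _") for y
  proof
    assume y: "?P y"
    then have "c0.supp x' y = {}" by (metis card_0_eq le_zero_eq)
    then show "y = 0" using y by (simp add: c0.proj_def)
  qed (simp add: supp_0 c0.proj_def)
  then show ?thesis by (simp only: c0.sigma_def) simp
qed

lemma sigma_greatest:
  assumes "\<And>B y. B \<subseteq> {2..} \<Longrightarrow> finite B \<Longrightarrow> card B \<le> m \<Longrightarrow> y \<in> c0.span (x ` B) \<Longrightarrow> r \<le> norm (v - y)"
  shows "r \<le> c0.sigma x x' m v"
  unfolding c0.sigma_def
proof (rule cInf_greatest)
  have "finite (c0.supp x' 0) \<and> card (c0.supp x' 0) \<le> m \<and> (0 :: 'k c0) = c0.proj x x' (c0.supp x' 0) 0"
    by (simp add: supp_0 c0.proj_def)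
  then show "{norm (v - y) |y. finite (c0.supp x' y) \<and> card (c0.supp x' y) \<le> m \<and>
        y = c0.proj x x' (c0.supp x' y) y} \<noteq> {}"
    by blast
next
  fix d assume "d \<in> {norm (v - y) |y. finite (c0.supp x' y) \<and> card (c0.supp x' y) \<le> m \<and>
        y = c0.proj x x' (c0.supp x' y) y}"
  then obtain y where y: "d = norm (v - y)" "finite (c0.supp x' y)" "card (c0.supp x' y) \<le> m"
      "y = c0.proj x x' (c0.supp x' y) y" by blast
  then have "y \<in> c0.span (x ` c0.supp x' y)" using c0.proj_in_span by metis
  then show "r \<le> d"
    unfolding y(1) using y(2,3) by (intro assms[of "c0.supp x' y"]) (auto simp: c0.supp_def)
qed

lemma thresholding_error_le_sigma:
  assumes \<tau>: "0 < \<tau>" "\<tau> \<le> 1" and W: "c0.weak_thresholding_set x' \<tau> v m W"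
  shows "norm (v - best W v) \<le> 3 * inverse \<tau> * c0.sigma x x' m v"
proof -
  have "norm (v - best W v) / (3 * inverse \<tau>) \<le> c0.sigma x x' m v"
  proof (rule sigma_greatest)
    fix B y assume "B \<subseteq> {2..}" "finite B" "card B \<le> m" "y \<in> c0.span (x ` B)"
    from thresholding_error_le[OF \<tau> W this]
    show "norm (v - best W v) / (3 * inverse \<tau>) \<le> norm (v - y)"
      using \<tau>(1) by (subst pos_divide_le_eq) (auto simp: mult.commute)
  qed
  then show ?thesis using \<tau>(1) by (subst (asm) pos_divide_le_eq) (auto simp: mult.commute)
qed

text \<open>
  With the existential quantifier over approximants replaced by the explicit best one, the condition
  becomes a family of affine inequalities in \<open>M\<close>, which an infimum of solutions inherits.
\<close>

lemma semi_greedy_bound_iff: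
  "c0.semi_greedy_bound x x' M \<longleftrightarrow> M > 0 \<and>
     (\<forall>v m \<rho>. c0.greedy_ordering x' v \<rho> \<longrightarrow>
        norm (v - best (c0.greedy_set \<rho> m) v) \<le> M * c0.sigma x x' m v)"
proof -
  have "(\<exists>z\<in>c0.span (x ` W). norm (v - z) \<le> r) \<longleftrightarrow> norm (v - best W v) \<le> r"
    if "W \<subseteq> {2..}" "finite W" for W v r
    using best_is_best[OF that] best_in_span by (meson order_trans)
  moreover have "c0.greedy_set \<rho> m \<subseteq> {2..} \<and> finite (c0.greedy_set \<rho> m)"
    if "c0.greedy_ordering x' v \<rho>" for v \<rho> m
    using c0.greedy_set_weak_thresholding[OF that] by (auto simp: c0.weak_thresholding_set_def)
  ultimately show ?thesis unfolding c0.semi_greedy_bound_def by meson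
qed

lemma semi_greedy_bound_3: "c0.semi_greedy_bound x x' 3"
  unfolding semi_greedy_bound_iff
proof (intro conjI allI impI)
  fix v m \<rho> assume "c0.greedy_ordering x' v \<rho>"
  from thresholding_error_le_sigma[OF _ _ c0.greedy_set_weak_thresholding[OF this], of m]
  show "norm (v - best (c0.greedy_set \<rho> m) v) \<le> 3 * c0.sigma x x' m v" by simp
qed simp

text \<open>
  For \<open>m = 0\<close> both the error and \<open>\<sigma>\<^sub>m(v)\<close> are the norm of \<open>v\<close>. A positive lower bound is
  needed because the infimum of the admissible constants has to be positive itself.
\<close>

lemma semi_greedy_bound_ge_1:
  assumes "c0.semi_greedy_bound x x' M"
  shows "1 \<le> M"
proof -
  define v :: "'k c0" where "v = c0_unit 1"
  have "norm (coord v 1) = 1" by (simp add: v_def c0_unit.rep_eq)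
  then have "norm v > 0" using norm_coord_le[of v 1] by linarith
  obtain \<rho> where "c0.greedy_ordering x' v \<rho>"
    using c0.greedy_ordering_exists[OF fundamental biorthogonal bounded] by blast
  then have "norm (v - best (c0.greedy_set \<rho> 0) v) \<le> M * c0.sigma x x' 0 v"
    using assms unfolding semi_greedy_bound_iff by blast
  then have "norm v \<le> M * norm v"
    by (simp add: sigma_0 best_def c0.greedy_set_def)
  then show ?thesis using \<open>norm v > 0\<close> by simp
qed

lemma semi_greedy_constant: "\<exists>M\<le>3. c0.is_semi_greedy_constant x x' M"
proof -
  let ?S = "{M. c0.semi_greedy_bound x x' M}"
  define M where "M = Inf ?S"
  have bdd: "bdd_below ?S" using semi_greedy_bound_ge_1 by (auto simp: bdd_below_def)
  have ne: "?S \<noteq> {}" using semi_greedy_bound_3 by blast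
  have le: "M \<le> M'" if "c0.semi_greedy_bound x x' M'" for M'
    unfolding M_def using that bdd by (intro cInf_lower) auto
  have "1 \<le> M" unfolding M_def using ne semi_greedy_bound_ge_1 by (intro cInf_greatest) auto
  have "norm (v - best (c0.greedy_set \<rho> m) v) \<le> M * c0.sigma x x' m v"
    if \<rho>: "c0.greedy_ordering x' v \<rho>" for v m \<rho>
  proof -
    let ?E = "norm (v - best (c0.greedy_set \<rho> m) v)" and ?s = "c0.sigma x x' m v"
    have E: "?E \<le> M' * ?s" if "M' \<in> ?S" for M'
      using that \<rho> by (auto simp: semi_greedy_bound_iff)
    have "0 \<le> ?s" by (rule sigma_greatest) simp
    show ?thesis
    proof (cases "?s = 0")
      case True
      then show ?thesis using E[of 3] semi_greedy_bound_3 by simp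
    next
      case False
      then have "?s > 0" using \<open>0 \<le> ?s\<close> by simp
      then have "?E / ?s \<le> M"
        unfolding M_def using ne E by (intro cInf_greatest) (auto simp: pos_divide_le_eq)
      then show ?thesis using \<open>?s > 0\<close> by (simp add: pos_divide_le_eq)
    qed
  qed
  then have "c0.semi_greedy_bound x x' M"
    using \<open>1 \<le> M\<close> by (auto simp: semi_greedy_bound_iff)
  then show ?thesis
    using le semi_greedy_bound_3 by (auto simp: c0.is_semi_greedy_constant_def)
qed

end

theorem mainTheorem3:
  fixes x :: "nat \<Rightarrow> 'k::{real_normed_field, heine_borel} c0"
    and x' :: "nat \<Rightarrow> 'k c0 \<Rightarrow> 'k"
  assumes x_eq: "\<And>i. 2 \<le> i \<Longrightarrow> x i = c0_unit i + c0_scale ((-1) ^ i) (c0_unit 1)"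
    and x'_eq: "\<And>i. 2 \<le> i \<Longrightarrow> x' i = c0_functional i"
  shows "(c0.fundamental x \<and> c0.minimal x \<and> c0.biorthogonal x x' \<and>
            \<not> c0.markushevich_basis x \<and> \<not> c0.quasi_greedy x x') \<and>
         \<not> c0.democratic x \<and>
         c0.semi_greedy x x' \<and> (\<exists>M\<le>3. c0.is_semi_greedy_constant x x' M) \<and>
         (\<forall>\<tau> v m W. 0 < \<tau> \<and> \<tau> \<le> 1 \<and> c0.weak_thresholding_set x' \<tau> v m W \<longrightarrow>
            (\<exists>b. norm (v - (\<Sum>i\<in>W. c0_scale (b i) (x i))) \<le> 3 * inverse \<tau> * c0.sigma x x' m v))"
proof -
  interpret alternating_system x x'
    using assms by unfold_locales auto
  have minimal: "c0.minimal x"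
    using biorthogonal by (auto simp: c0.minimal_def)
  have semi_greedy: "c0.semi_greedy x x'"
    using bounded semi_greedy_bound_3 by (auto simp: c0.semi_greedy_def)
  have weak: "\<exists>b. norm (v - (\<Sum>i\<in>W. c0_scale (b i) (x i))) \<le> 3 * inverse \<tau> * c0.sigma x x' m v"
    if "0 < \<tau>" "\<tau> \<le> 1" "c0.weak_thresholding_set x' \<tau> v m W" for \<tau> v m W
    using thresholding_error_le_sigma[OF that] unfolding best_def by blast
  show ?thesis
    using fundamental minimal biorthogonal not_markushevich not_quasi_greedy not_democratic
      semi_greedy semi_greedy_constant weak by blast
qed

end
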